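(* Let $X, Y$ be normed vector spaces, let $\Omega\subset X$ and $\Theta\subset Y$ be nonempty convex sets, let $\sigma\ge 0$ and $\gamma>0$. Suppose that $f\colon \Theta\to[-\infty,\infty]$ is $\sigma$-quasiconvex and that $F\colon\Omega\rightrightarrows\Theta$ is a convex set-valued map which is $\gamma$-expansive. Then the optimal value function $\mu\colon\Omega\to[-\infty,\infty]$ defined by $$\mu(x)=\inf\{f(y)\mid y\in F(x)\},\quad x\in\Omega,$$ is $\frac{\sigma}{\gamma^2}$-quasiconvex.
   Context: All normed vector spaces are real and nontrivial. Convention: $\inf\emptyset=\infty$. Let $\sigma\ge 0$ and let $C$ be a nonempty convex subset of a normed vector space. A function $f\colon C\to[-\infty,\infty]$ is $\sigma$-quasiconvex if $f(\lambda x+(1-\lambda)y)\le\max\{f(x),f(y)\}-\frac{\sigma}{2}\lambda(1-\lambda)\|x-y\|^2$ for all $x,y\in C$ and $0<\lambda<1$. A set-valued map $F\colon\Omega\rightrightarrows\Theta$ assigns to each $x\in\Omega$ a (possibly empty) subset $F(x)\subset\Theta$. It is convex if its graph $\{(x,y)\in\Omega\times\Theta\mid y\in F(x)\}$ is a convex subset of $X\times Y$. It is $\gamma$-expansive ($\gamma>0$) if $\|x_1-x_2\|\le\gamma\|y_1-y_2\|$ whenever $x_1,x_2\in\Omega$, $y_1\in F(x_1)$, $y_2\in F(x_2)$. *)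

theory Defs
  imports "HOL-Analysis.Analysis"
begin

text \<open>
  Functions on a set \<open>C\<close> are represented by total functions; only their values on \<open>C\<close> matter.
  The subtrahend is a finite real, so no indeterminate difference of extended reals arises.
\<close>

definition quasiconvex_on :: "real \<Rightarrow> 'a::real_normed_vector set \<Rightarrow> ('a \<Rightarrow> ereal) \<Rightarrow> bool" where
  "quasiconvex_on \<sigma> C f \<longleftrightarrow>
     (\<forall>x\<in>C. \<forall>y\<in>C. \<forall>l::real. 0 < l \<and> l < 1 \<longrightarrow>
        f (l *\<^sub>R x + (1 - l) *\<^sub>R y)
          \<le> max (f x) (f y) - ereal (\<sigma> / 2 * l * (1 - l) * (norm (x - y))\<^sup>2))"

definition set_valued_map :: "'a set \<Rightarrow> 'b set \<Rightarrow> ('a \<Rightarrow> 'b set) \<Rightarrow> bool" where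
  "set_valued_map \<Omega> \<Theta> F \<longleftrightarrow> (\<forall>x\<in>\<Omega>. F x \<subseteq> \<Theta>)"

definition svm_graph :: "'a set \<Rightarrow> 'b set \<Rightarrow> ('a \<Rightarrow> 'b set) \<Rightarrow> ('a \<times> 'b) set" where
  "svm_graph \<Omega> \<Theta> F = {(x, y). x \<in> \<Omega> \<and> y \<in> \<Theta> \<and> y \<in> F x}"

definition convex_svm ::
  "'a::real_vector set \<Rightarrow> 'b::real_vector set \<Rightarrow> ('a \<Rightarrow> 'b set) \<Rightarrow> bool" where
  "convex_svm \<Omega> \<Theta> F \<longleftrightarrow> convex (svm_graph \<Omega> \<Theta> F)"

definition expansive_svm ::
  "real \<Rightarrow> 'a::real_normed_vector set \<Rightarrow> ('a \<Rightarrow> 'b::real_normed_vector set) \<Rightarrow> bool" where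
  "expansive_svm \<gamma> \<Omega> F \<longleftrightarrow>
     (\<forall>x1\<in>\<Omega>. \<forall>x2\<in>\<Omega>. \<forall>y1\<in>F x1. \<forall>y2\<in>F x2. norm (x1 - x2) \<le> \<gamma> * norm (y1 - y2))"

text \<open>The infimum over the empty set is \<open>\<infinity>\<close>, the top element of \<^typ>\<open>ereal\<close>.\<close>

definition optimal_value :: "('b \<Rightarrow> ereal) \<Rightarrow> ('a \<Rightarrow> 'b set) \<Rightarrow> 'a \<Rightarrow> ereal" where
  "optimal_value f F x = Inf {f y | y. y \<in> F x}"

end

theory Submission
  imports Defs
begin

text \<open>
  Any level \<open>M\<close> strictly above both optimal values is beaten by feasible points of \<open>F x1\<close>
  and \<open>F x2\<close>. Convexity of the graph makes their convex combination feasible, and expansiveness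
  turns the modulus \<open>\<sigma>\<close> in the second variable into \<open>\<sigma> / \<gamma>\<^sup>2\<close> in the first. Working
  with strict levels also covers an empty \<open>F x1\<close> or \<open>F x2\<close> and infinite values of \<open>f\<close>.
\<close>

theorem theorem2p6:
  fixes \<Omega> :: "'a::real_normed_vector set" and \<Theta> :: "'b::real_normed_vector set"
    and \<sigma> \<gamma> :: real and f :: "'b \<Rightarrow> ereal" and F :: "'a \<Rightarrow> 'b set"
  assumes "\<exists>x::'a. x \<noteq> 0" and "\<exists>y::'b. y \<noteq> 0"
    and "\<Omega> \<noteq> {}" and "convex \<Omega>"
    and "\<Theta> \<noteq> {}" and "convex \<Theta>"
    and "\<sigma> \<ge> 0" and "\<gamma> > 0"
    and "quasiconvex_on \<sigma> \<Theta> f"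
    and "set_valued_map \<Omega> \<Theta> F"
    and "convex_svm \<Omega> \<Theta> F"
    and "expansive_svm \<gamma> \<Omega> F"
  shows "quasiconvex_on (\<sigma> / \<gamma>\<^sup>2) \<Omega> (optimal_value f F)"
  unfolding quasiconvex_on_def
proof (intro ballI allI impI)
  fix x1 x2 and l :: real
  assume x: "x1 \<in> \<Omega>" "x2 \<in> \<Omega>" and l: "0 < l \<and> l < 1"
  define z where "z = l *\<^sub>R x1 + (1 - l) *\<^sub>R x2"
  define c where "c = \<sigma> / \<gamma>\<^sup>2 / 2 * l * (1 - l) * (norm (x1 - x2))\<^sup>2"
  \<comment> \<open>The finite \<open>c\<close> stands on the left, so that the right side is a bare
    level \<open>M\<close> and a density argument can finish.\<close>
  have "optimal_value f F z + ereal c \<le> M"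
    if M: "max (optimal_value f F x1) (optimal_value f F x2) < M" for M
  proof -
    \<comment> \<open>The infima need not be attained, but an infimum below \<open>M\<close> has a
      member below \<open>M\<close>. If \<open>F x1\<close> or \<open>F x2\<close> is empty, the
      maximum is \<infinity> and no such \<open>M\<close> exists.\<close>
    obtain y1 y2 where y: "y1 \<in> F x1" "y2 \<in> F x2" and fy: "f y1 < M" "f y2 < M"
      using M by (auto simp: optimal_value_def Inf_less_iff)
    define w where "w = l *\<^sub>R y1 + (1 - l) *\<^sub>R y2"
    define d where "d = \<sigma> / 2 * l * (1 - l) * (norm (y1 - y2))\<^sup>2"
    have y\<Theta>: "y1 \<in> \<Theta>" "y2 \<in> \<Theta>"
      using x y \<open>set_valued_map \<Omega> \<Theta> F\<close> by (auto simp: set_valued_map_def)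
    have "l *\<^sub>R (x1, y1) + (1 - l) *\<^sub>R (x2, y2) \<in> svm_graph \<Omega> \<Theta> F"
      using \<open>convex_svm \<Omega> \<Theta> F\<close> l x y y\<Theta>
      by (intro convexD) (auto simp: convex_svm_def svm_graph_def)
    then have "w \<in> F z"
      by (simp add: svm_graph_def w_def z_def)
    then have "optimal_value f F z \<le> f w"
      by (auto simp: optimal_value_def intro: Inf_lower)
    also have "\<dots> \<le> max (f y1) (f y2) - ereal d"
      using \<open>quasiconvex_on \<sigma> \<Theta> f\<close> y\<Theta> l by (auto simp: quasiconvex_on_def w_def d_def)
    \<comment> \<open>Since \<open>d\<close> is a finite real, it can change sides even where
      \<open>f\<close> is infinite.\<close>
    finally have "optimal_value f F z + ereal d \<le> max (f y1) (f y2)"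
      by (simp add: ereal_le_minus)
    moreover have "c \<le> d"
    proof -
      have "norm (x1 - x2) \<le> \<gamma> * norm (y1 - y2)"
        using \<open>expansive_svm \<gamma> \<Omega> F\<close> x y by (auto simp: expansive_svm_def)
      then have "(norm (x1 - x2))\<^sup>2 \<le> (\<gamma> * norm (y1 - y2))\<^sup>2"
        by (simp add: power_mono)
      then have "(norm (x1 - x2))\<^sup>2 / \<gamma>\<^sup>2 \<le> (norm (y1 - y2))\<^sup>2"
        using \<open>\<gamma> > 0\<close> by (simp add: divide_le_eq power_mult_distrib mult.commute)
      \<comment> \<open>The common factor \<open>\<sigma> / 2 * l * (1 - l)\<close> is nonnegative,
        so it preserves the comparison of squared distances.\<close>
      then have "\<sigma> / 2 * l * (1 - l) * ((norm (x1 - x2))\<^sup>2 / \<gamma>\<^sup>2) \<le> d"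
        unfolding d_def using \<open>\<sigma> \<ge> 0\<close> l by (intro mult_left_mono) auto
      then show ?thesis
        by (simp add: c_def)
    qed
    ultimately show ?thesis
      using fy by (meson add_left_mono ereal_less_eq(3) le_less_trans less_imp_le max_less_iff_conj order_trans)
  qed
  \<comment> \<open>The order on \<open>ereal\<close> is dense, so a value exceeding the maximum
    would leave room for some \<open>M\<close> strictly between them.\<close>
  then have "optimal_value f F z + ereal c \<le> max (optimal_value f F x1) (optimal_value f F x2)"
    by (rule dense_ge)
  then show "optimal_value f F (l *\<^sub>R x1 + (1 - l) *\<^sub>R x2)
      \<le> max (optimal_value f F x1) (optimal_value f F x2)
        - ereal (\<sigma> / \<gamma>\<^sup>2 / 2 * l * (1 - l) * (norm (x1 - x2))\<^sup>2)"
    unfolding z_def[symmetric] c_def[symmetric]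
    by (simp add: ereal_le_minus)
qed

end
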